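(* Every outerplanar pattern has merge-width at most $2$.
   Context: A pattern $P$ consists of a finite totally ordered vertex set $V(P)$ with a partition of the unordered pairs of distinct vertices into mandatory edges $M(P)$, forbidden edges $F(P)$ and undecided pairs $U(P)$; write $E(P)=M(P)\cup F(P)$ (each element keeping its type), whose elements are called edges. Two edges $(i,j),(i',j')$ with $i<j$, $i'<j'$ cross if $i<i'<j<j'$ or $i'<i<j'<j$. $P$ is outerplanar if no two of its edges cross. An anchored pattern is a pattern with a distinguished subset of vertices called anchors. An anchored pattern $P=(V,E)$ is a merge of anchored patterns $P_1=(V_1,E_1)$, $P_2=(V_2,E_2)$ (with $V_1,V_2\subseteq V$ carrying the induced order, edges keeping their type) if: (a) $(E_1,E_2)$ is a partition of $E$ and every edge of $E_i$ has both endpoints in $V_i$; (b) $V_1\cup V_2=V$; (c) every vertex of $V_1\cap V_2$ is an anchor in both $P_1$ and $P_2$; (d) every anchor of $P$ is an anchor in each $P_i$ containing it; (e) there are no two consecutive vertices of $V$ such that one belongs only to $V_1$ and the other only to $V_2$. An anchored pattern $P$ is obtained from $P'$ by a vertex creation if $P$ is $P'$ with one additional isolated vertex inserted into the order, where in $P'$ the vertices immediately before and after the insertion position (when they exist) are anchors. An edge-creation pattern is an anchored pattern with two vertices whose pair is a single mandatory or forbidden edge. A merge tree for $P$ is a rooted tree whose nodes are labeled by anchored patterns, the root labeled by $P$ with some set of anchors, each leaf by an edge-creation pattern, each node with one child by a pattern obtained by vertex creation from its child's label, and each node with two children by a merge of its children's labels. The width of a merge tree is the maximum number of anchors of a label;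 the merge-width of $P$ is the minimum width over merge trees for $P$.
   Formalization: A pattern with no edges has no merge tree, so its merge-width is undefined; it is set to 0 by convention. In a vertex creation the anchors of the new pattern may be chosen freely, as the definition literally allows; if old vertices could not become anchors again, the claim would fail. *)

theory Defs
  imports Main "HOL-Library.Extended_Nat"
begin

(* An unordered pair of distinct vertices is represented by the ordered pair (i, j) with i < j.
   The undecided pairs are the pairs of vertices in neither mand nor forb. *)
record 'a pattern =
  verts :: "'a set"
  mand :: "('a \<times> 'a) set"
  forb :: "('a \<times> 'a) set"

definition edges :: "('a, 'b) pattern_scheme \<Rightarrow> ('a \<times> 'a) set" where
  "edges P = mand P \<union> forb P"

definition is_pattern :: "('a::linorder, 'b) pattern_scheme \<Rightarrow> bool" where
  "is_pattern P \<longleftrightarrow>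
     finite (verts P) \<and>
     edges P \<subseteq> {(i, j). i \<in> verts P \<and> j \<in> verts P \<and> i < j} \<and>
     mand P \<inter> forb P = {}"

definition cross :: "'a::linorder \<times> 'a \<Rightarrow> 'a \<times> 'a \<Rightarrow> bool" where
  "cross e f \<longleftrightarrow>
     (fst e < fst f \<and> fst f < snd e \<and> snd e < snd f) \<or>
     (fst f < fst e \<and> fst e < snd f \<and> snd f < snd e)"

definition outerplanar :: "('a::linorder, 'b) pattern_scheme \<Rightarrow> bool" where
  "outerplanar P \<longleftrightarrow> (\<forall>e\<in>edges P. \<forall>f\<in>edges P. \<not> cross e f)"

record 'a anchored_pattern = "'a pattern" +
  anchors :: "'a set"

definition is_anchored_pattern :: "'a::linorder anchored_pattern \<Rightarrow> bool" where
  "is_anchored_pattern P \<longleftrightarrow> is_pattern P \<and> anchors P \<subseteq> verts P"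

definition consecutive :: "'a::linorder set \<Rightarrow> 'a \<Rightarrow> 'a \<Rightarrow> bool" where
  "consecutive V u v \<longleftrightarrow> u \<in> V \<and> v \<in> V \<and> u < v \<and> (\<forall>w\<in>V. \<not> (u < w \<and> w < v))"

(* That every edge of P1 (P2) has both endpoints in verts P1 (verts P2) is part of
   is_anchored_pattern, which is_merge_tree below demands of all labels. *)
definition is_merge ::
  "'a::linorder anchored_pattern \<Rightarrow> 'a anchored_pattern \<Rightarrow> 'a anchored_pattern \<Rightarrow> bool" where
  "is_merge P P1 P2 \<longleftrightarrow>
     mand P = mand P1 \<union> mand P2 \<and> forb P = forb P1 \<union> forb P2 \<and>
     edges P1 \<inter> edges P2 = {} \<and>
     verts P1 \<union> verts P2 = verts P \<and>
     (\<forall>v \<in> verts P1 \<inter> verts P2. v \<in> anchors P1 \<and> v \<in> anchors P2) \<and>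
     (\<forall>v \<in> anchors P.
        (v \<in> verts P1 \<longrightarrow> v \<in> anchors P1) \<and> (v \<in> verts P2 \<longrightarrow> v \<in> anchors P2)) \<and>
     \<not> (\<exists>u v. consecutive (verts P) u v \<and>
          ((u \<in> verts P1 - verts P2 \<and> v \<in> verts P2 - verts P1) \<or>
           (u \<in> verts P2 - verts P1 \<and> v \<in> verts P1 - verts P2)))"

(* A vertex creation constrains the anchors of the smaller pattern P' only: the anchors of the
   resulting pattern P may be chosen freely. *)
definition is_vertex_creation ::
  "'a::linorder anchored_pattern \<Rightarrow> 'a anchored_pattern \<Rightarrow> bool" where
  "is_vertex_creation P P' \<longleftrightarrow>
     (\<exists>v. v \<notin> verts P' \<and> verts P = insert v (verts P') \<and>
          mand P = mand P' \<and> forb P = forb P' \<and>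
          (\<forall>u. consecutive (verts P) u v \<or> consecutive (verts P) v u \<longrightarrow> u \<in> anchors P'))"

definition is_edge_creation :: "'a::linorder anchored_pattern \<Rightarrow> bool" where
  "is_edge_creation P \<longleftrightarrow>
     (\<exists>i j. i < j \<and> verts P = {i, j} \<and>
        ((mand P = {(i, j)} \<and> forb P = {}) \<or> (mand P = {} \<and> forb P = {(i, j)})))"

datatype (labels: 'l) ltree =
    Leaf (label: 'l)
  | Unary (label: 'l) "'l ltree"
  | Binary (label: 'l) "'l ltree" "'l ltree"

primrec is_merge_tree :: "'a::linorder anchored_pattern ltree \<Rightarrow> bool" where
  "is_merge_tree (Leaf P) \<longleftrightarrow> is_anchored_pattern P \<and> is_edge_creation P"
| "is_merge_tree (Unary P t) \<longleftrightarrow>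
     is_anchored_pattern P \<and> is_vertex_creation P (label t) \<and> is_merge_tree t"
| "is_merge_tree (Binary P t1 t2) \<longleftrightarrow>
     is_anchored_pattern P \<and> is_merge P (label t1) (label t2) \<and>
     is_merge_tree t1 \<and> is_merge_tree t2"

(* truncate forgets the anchors of the root label *)
definition merge_tree_for :: "'a::linorder anchored_pattern ltree \<Rightarrow> 'a pattern \<Rightarrow> bool" where
  "merge_tree_for t P \<longleftrightarrow> is_merge_tree t \<and> pattern.truncate (label t) = P"

definition width :: "'a anchored_pattern ltree \<Rightarrow> nat" where
  "width t = Max ((\<lambda>P. card (anchors P)) ` labels t)"

(* Every leaf of a merge tree carries an edge, so a pattern without edges has no merge tree and
   the minimum is over the empty set; by convention such a pattern has merge-width 0.  A pattern
   that has edges but no merge tree gets the value \<infinity>. *)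
definition merge_width :: "'a::linorder pattern \<Rightarrow> enat" where
  "merge_width P =
     (if edges P = {} then 0 else (INF t \<in> {t. merge_tree_for t P}. enat (width t)))"

end

theory Submission
  imports Defs
begin

text \<open>
  By induction on the number of vertices and edges, a noncrossing pattern with least vertex
  \<open>a\<close>, greatest vertex \<open>b\<close> and at least one edge is the root of a merge tree of width at most 2
  in which exactly \<open>a\<close> and \<open>b\<close> are anchors at the root. If \<open>a\<close> or \<open>b\<close> is isolated, it is created
  last. If \<open>(a, b)\<close> is an edge, it is split off, unless it is the only one; in that case the other
  vertices are created one by one, since the anchors after a vertex creation are arbitrary.
  Otherwise let \<open>c < b\<close> be the greatest neighbour of \<open>a\<close>. No edge passes over \<open>c\<close>, as it would
  cross \<open>(a, c)\<close> or have \<open>a\<close> as an endpoint, so the pattern is the merge of its parts left and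
  right of \<open>c\<close>.
\<close>

section \<open>Merge trees with a bound on the number of anchors\<close>

text \<open>Bounding each label separately, instead of through the maximum in \<open>width\<close>,
  lets bounds pass directly from subtrees to larger trees. The root label keeps its anchors because
  creations and merges put conditions on them.\<close>

definition realizable :: "nat \<Rightarrow> 'a::linorder anchored_pattern \<Rightarrow> bool" where
  "realizable k P \<longleftrightarrow>
     (\<exists>t. is_merge_tree t \<and> label t = P \<and> (\<forall>Q\<in>labels t. card (anchors Q) \<le> k))"

lemma realizable_edge_creation:
  assumes "is_anchored_pattern P" "is_edge_creation P" "card (anchors P) \<le> k"
  shows "realizable k P"
  unfolding realizable_def by (rule exI[of _ "Leaf P"]) (use assms in auto)

lemma realizable_vertex_creation:
  assumes "realizable k P'" "is_anchored_pattern P" "is_vertex_creation P P'"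
    "card (anchors P) \<le> k"
  shows "realizable k P"
proof -
  obtain t where "is_merge_tree t" "label t = P'" "\<forall>Q\<in>labels t. card (anchors Q) \<le> k"
    using assms(1) unfolding realizable_def by blast
  then show ?thesis
    unfolding realizable_def by (intro exI[of _ "Unary P t"]) (use assms in auto)
qed

lemma realizable_merge:
  assumes "realizable k P1" "realizable k P2" "is_anchored_pattern P" "is_merge P P1 P2"
    "card (anchors P) \<le> k"
  shows "realizable k P"
proof -
  obtain t1 where "is_merge_tree t1" "label t1 = P1" "\<forall>Q\<in>labels t1. card (anchors Q) \<le> k"
    using assms(1) unfolding realizable_def by blast
  moreover obtain t2 where "is_merge_tree t2" "label t2 = P2"
      "\<forall>Q\<in>labels t2. card (anchors Q) \<le> k"
    using assms(2) unfolding realizable_def by blast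
  ultimately show ?thesis
    unfolding realizable_def by (intro exI[of _ "Binary P t1 t2"]) (use assms in auto)
qed

lemma merge_width_le_if_realizable:
  assumes "realizable k P" "pattern.truncate P = Q"
  shows "merge_width Q \<le> enat k"
proof -
  obtain t where t: "is_merge_tree t" "label t = P" "\<forall>Q\<in>labels t. card (anchors Q) \<le> k"
    using assms(1) unfolding realizable_def by blast
  have "finite (labels t)" by (induction t) auto
  moreover have "labels t \<noteq> {}" by (cases t) auto
  ultimately have "width t \<le> k"
    unfolding width_def using t(3) by (subst Max_le_iff) auto
  moreover have "(INF t \<in> {t. merge_tree_for t Q}. enat (width t)) \<le> enat (width t)"
    using t assms(2) by (intro INF_lower) (simp add: merge_tree_for_def)
  ultimately show ?thesis
    unfolding merge_width_def by (auto simp: zero_enat_def intro: order_trans)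
qed

text \<open>A vertex has at most one predecessor and one successor. These are the vertices that must
  be anchors before it is created, so requiring them respects the bound 2.\<close>

lemma card_neighbours_le_2:
  assumes "finite V"
  shows "card {u. consecutive V u v \<or> consecutive V v u} \<le> 2"
proof -
  let ?L = "{u. consecutive V u v}" and ?R = "{u. consecutive V v u}"
  have fin: "finite ?L" "finite ?R"
    by (rule finite_subset[OF _ assms]; auto simp: consecutive_def)+
  have "u = w" if "consecutive V u v" "consecutive V w v" for u w
    using that unfolding consecutive_def by (meson linorder_neqE)
  then have "card ?L \<le> Suc 0"
    unfolding card_le_Suc0_iff_eq[OF fin(1)] by simp
  moreover have "u = w" if "consecutive V v u" "consecutive V v w" for u w
    using that unfolding consecutive_def by (meson linorder_neqE)
  then have "card ?R \<le> Suc 0"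
    unfolding card_le_Suc0_iff_eq[OF fin(2)] by simp
  moreover have "card (?L \<union> ?R) \<le> card ?L + card ?R" by (rule card_Un_le)
  moreover have "{u. consecutive V u v \<or> consecutive V v u} = ?L \<union> ?R" by blast
  ultimately show ?thesis by simp
qed

text \<open>The anchor set \<open>X\<close> is arbitrary so that the induction goes through: when a
  vertex is removed, the smaller pattern needs its neighbours as anchors, and these need not be
  \<open>a\<close> and \<open>b\<close>.\<close>

lemma realizable_single_edge:
  fixes a b :: "'a::linorder"
  assumes "finite V" "a \<in> V" "b \<in> V" "a < b" "M \<union> F = {(a, b)}" "M \<inter> F = {}"
    "X \<subseteq> V" "card X \<le> 2"
  shows "realizable 2 \<lparr>verts = V, mand = M, forb = F, anchors = X\<rparr>"
  using assms
proof (induction "card V" arbitrary: V X)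
  case 0
  then show ?case by auto
next
  case (Suc n)
  have anch: "is_anchored_pattern \<lparr>verts = V, mand = M, forb = F, anchors = X\<rparr>"
    using Suc.prems by (auto simp: is_anchored_pattern_def is_pattern_def edges_def)
  show ?case
  proof (cases "V = {a, b}")
    case True
    have "M = {(a, b)} \<and> F = {} \<or> M = {} \<and> F = {(a, b)}"
      using Suc.prems(5,6) by (auto simp: Un_singleton_iff)
    then have "is_edge_creation \<lparr>verts = V, mand = M, forb = F, anchors = X\<rparr>"
      unfolding is_edge_creation_def using True Suc.prems(4) by auto
    then show ?thesis
      using realizable_edge_creation[OF anch] Suc.prems(8) by simp
  next
    case False
    \<comment> \<open>Such a \<open>v\<close> is isolated, as the only edge is
      \<open>(a, b)\<close>, so it can be created last.\<close>
    then obtain v where v: "v \<in> V" "v \<noteq> a" "v \<noteq> b" using Suc.prems(2,3) by blast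
    let ?N = "{u. consecutive V u v \<or> consecutive V v u}"
    have "n = card (V - {v})" using Suc.hyps(2) v(1) Suc.prems(1) by simp
    moreover have "?N \<subseteq> V - {v}" by (auto simp: consecutive_def)
    ultimately have "realizable 2 \<lparr>verts = V - {v}, mand = M, forb = F, anchors = ?N\<rparr>"
      using Suc.prems v
      by (intro Suc.hyps(1)) (auto simp: card_neighbours_le_2)
    moreover have "is_vertex_creation \<lparr>verts = V, mand = M, forb = F, anchors = X\<rparr>
        \<lparr>verts = V - {v}, mand = M, forb = F, anchors = ?N\<rparr>"
      unfolding is_vertex_creation_def using v(1) by (intro exI[of _ v]) auto
    ultimately show ?thesis
      using realizable_vertex_creation anch Suc.prems(8) by fastforce
  qed
qed

section \<open>Decomposition of noncrossing patterns\<close>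

lemma realizable_noncrossing:
  fixes a b :: "'a::linorder"
  assumes "finite V" "a \<in> V" "b \<in> V" "V \<subseteq> {a..b}"
    "M \<union> F \<subseteq> {(i, j). i \<in> V \<and> j \<in> V \<and> i < j}" "M \<inter> F = {}"
    "\<And>e f. e \<in> M \<union> F \<Longrightarrow> f \<in> M \<union> F \<Longrightarrow> \<not> cross e f" "M \<union> F \<noteq> {}"
  shows "realizable 2 \<lparr>verts = V, mand = M, forb = F, anchors = {a, b}\<rparr>"
  using assms
proof (induction "card V + card (M \<union> F)" arbitrary: V M F a b rule: less_induct)
  case less
  let ?P = "\<lparr>verts = V, mand = M, forb = F, anchors = {a, b}\<rparr>"
  note prems = less.prems
  have anch: "is_anchored_pattern ?P"
    using prems(1-3,5,6) by (auto simp: is_anchored_pattern_def is_pattern_def edges_def)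
  have card2: "card (anchors ?P) \<le> 2" by (simp add: card_insert_if)
  have le: "a \<le> x" "x \<le> b" if "x \<in> V" for x using that prems(4) by auto
  have in_V: "i \<in> V" "j \<in> V" "i < j" if "(i, j) \<in> M \<union> F" for i j
    using that prems(5) by auto
  have finE: "finite (M \<union> F)"
    by (rule finite_subset[OF prems(5)], rule finite_subset[of _ "V \<times> V"]) (use prems(1) in auto)
  obtain i0 j0 where e0: "(i0, j0) \<in> M \<union> F" using prems(8) by auto
  have "a < b" using in_V[OF e0] le by force
  \<comment> \<open>Since \<open>a\<close> is least and \<open>b\<close> greatest, every edge at
    \<open>a\<close> starts there and every edge at \<open>b\<close> ends there; so
    \<open>left\<close> and \<open>right\<close> say that \<open>a\<close> and \<open>b\<close> are
    isolated.\<close>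
  consider (left) "\<forall>j. (a, j) \<notin> M \<union> F" | (right) "\<forall>i. (i, b) \<notin> M \<union> F"
    | (single) "M \<union> F = {(a, b)}" | (edge) "(a, b) \<in> M \<union> F" "M \<union> F - {(a, b)} \<noteq> {}"
    | (split) c d where "(a, c) \<in> M \<union> F" "(d, b) \<in> M \<union> F" "(a, b) \<notin> M \<union> F"
    by blast
  then show ?case
  proof cases
    case left
    let ?V = "V - {a}"
    have sub: "M \<union> F \<subseteq> {(i, j). i \<in> ?V \<and> j \<in> ?V \<and> i < j}"
      using in_V left le by fastforce
    have ne: "?V \<noteq> {}" "finite ?V" using sub e0 prems(1) by auto
    \<comment> \<open>The only neighbour of \<open>a\<close> in the order is the new least vertex
      \<open>a'\<close>, which the induction hypothesis makes an anchor.\<close>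
    define a' where "a' = Min ?V"
    have a': "a' \<in> ?V" "\<And>x. x \<in> V \<Longrightarrow> x \<noteq> a \<Longrightarrow> a' \<le> x"
      unfolding a'_def using Min_in[OF ne(2,1)] Min_le[OF ne(2)] by auto
    have "realizable 2 \<lparr>verts = ?V, mand = M, forb = F, anchors = {a', b}\<rparr>"
    proof (rule less.hyps)
      show "card ?V + card (M \<union> F) < card V + card (M \<union> F)"
        using prems(1,2) by (simp add: card_Diff1_less del: card_Diff_insert)
      show "?V \<subseteq> {a'..b}" using a'(2) le(2) by (metis Diff_iff atLeastAtMost_iff singletonI subsetI)
      show "\<not> cross e f" if "e \<in> M \<union> F" "f \<in> M \<union> F" for e f
        by (rule prems(7)) (use that in blast)+
    qed (use ne a'(1) sub prems(1-3,6,8) \<open>a < b\<close> in auto)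
    moreover have "is_vertex_creation ?P \<lparr>verts = ?V, mand = M, forb = F, anchors = {a', b}\<rparr>"
    proof -
      have "u = a'" if "consecutive V u a \<or> consecutive V a u" for u
        using that a' le(1) unfolding consecutive_def
        by (metis Diff_iff antisym_conv3 insertI1 leD singletonD)
      then show ?thesis
        unfolding is_vertex_creation_def using prems(2) by (intro exI[of _ a]) (auto simp: insert_absorb)
    qed
    ultimately show ?thesis using realizable_vertex_creation anch card2 by blast
  next
    case right
    let ?V = "V - {b}"
    have sub: "M \<union> F \<subseteq> {(i, j). i \<in> ?V \<and> j \<in> ?V \<and> i < j}"
      using in_V right le by fastforce
    have ne: "?V \<noteq> {}" "finite ?V" using sub e0 prems(1) by auto
    define b' where "b' = Max ?V"
    have b': "b' \<in> ?V" "\<And>x. x \<in> V \<Longrightarrow> x \<noteq> b \<Longrightarrow> x \<le> b'"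
      unfolding b'_def using Max_in[OF ne(2,1)] Max_ge[OF ne(2)] by auto
    have "realizable 2 \<lparr>verts = ?V, mand = M, forb = F, anchors = {a, b'}\<rparr>"
    proof (rule less.hyps)
      show "card ?V + card (M \<union> F) < card V + card (M \<union> F)"
        using prems(1,3) by (simp add: card_Diff1_less del: card_Diff_insert)
      show "?V \<subseteq> {a..b'}" using b'(2) le(1) by (metis Diff_iff atLeastAtMost_iff singletonI subsetI)
      show "\<not> cross e f" if "e \<in> M \<union> F" "f \<in> M \<union> F" for e f
        by (rule prems(7)) (use that in blast)+
    qed (use ne b'(1) sub prems(1-3,6,8) \<open>a < b\<close> in auto)
    moreover have "is_vertex_creation ?P \<lparr>verts = ?V, mand = M, forb = F, anchors = {a, b'}\<rparr>"
    proof -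
      have "u = b'" if "consecutive V u b \<or> consecutive V b u" for u
        using that b' le(2) unfolding consecutive_def
        by (metis Diff_iff antisym_conv3 insertI1 leD singletonD)
      then show ?thesis
        unfolding is_vertex_creation_def using prems(3) by (intro exI[of _ b]) (auto simp: insert_absorb)
    qed
    ultimately show ?thesis using realizable_vertex_creation anch card2 by blast
  next
    case single
    show ?thesis
      by (rule realizable_single_edge[OF _ _ _ \<open>a < b\<close> single]) (use prems(1-3,6) card2 in auto)
  next
    case edge
    \<comment> \<open>The first part keeps all vertices, so no vertex belongs only to the second
      part and the condition on consecutive vertices holds. The measure counts edges as well as
      vertices because here only an edge is lost.\<close>
    let ?P1 = "\<lparr>verts = V, mand = M - {(a, b)}, forb = F - {(a, b)}, anchors = {a, b}\<rparr>"
    let ?P2 = "\<lparr>verts = {a, b}, mand = M \<inter> {(a, b)}, forb = F \<inter> {(a, b)}, anchors = {a, b}\<rparr>"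
    have "realizable 2 ?P1"
    proof (rule less.hyps)
      have "M - {(a, b)} \<union> (F - {(a, b)}) \<subset> M \<union> F" using edge(1) by blast
      then show "card V + card (M - {(a, b)} \<union> (F - {(a, b)})) < card V + card (M \<union> F)"
        using psubset_card_mono[OF finE] by simp
      show "\<not> cross e f" if "e \<in> M - {(a, b)} \<union> (F - {(a, b)})" "f \<in> M - {(a, b)} \<union> (F - {(a, b)})" for e f
        by (rule prems(7)) (use that in blast)+
    qed (use edge(2) prems(1-6,8) in auto)
    moreover have "realizable 2 ?P2"
      by (rule realizable_single_edge) (use edge(1) prems(6) \<open>a < b\<close> card2 in auto)
    moreover have "is_merge ?P ?P1 ?P2"
      unfolding is_merge_def using prems(2,3) by (auto simp: edges_def)
    ultimately show ?thesis using realizable_merge anch card2 by blast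
  next
    case (split c0 d)
    define c where "c = Max {x. (a, x) \<in> M \<union> F}"
    have "finite {x. (a, x) \<in> M \<union> F}"
      by (rule finite_subset[OF _ prems(1)]) (use in_V in auto)
    then have ac: "(a, c) \<in> M \<union> F" and c_max: "\<And>x. (a, x) \<in> M \<union> F \<Longrightarrow> x \<le> c"
      unfolding c_def using split(1) Max_in[of "{x. (a, x) \<in> M \<union> F}"] by auto
    \<comment> \<open>\<open>c\<close> differs from \<open>b\<close> because \<open>(a, b)\<close>
      is not an edge in this case.\<close>
    have c: "c \<in> V" "a < c" "c < b"
      using in_V[OF ac] le ac split(3) by (auto simp: order.strict_iff_order)
    have side: "j \<le> c \<or> c \<le> i" if ij: "(i, j) \<in> M \<union> F" for i j
    proof (rule ccontr)
      assume "\<not> (j \<le> c \<or> c \<le> i)"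
      moreover from this have "a < i"
        using c_max ij le(1)[OF in_V(1)[OF ij]] by (auto simp: order.strict_iff_order)
      ultimately show False
        using prems(7)[OF ac ij] by (auto simp: cross_def)
    qed
    \<comment> \<open>Both parts contain \<open>c\<close>, their only common vertex and an anchor of
      each. By \<open>side\<close> every edge falls into one of them, and into only one because its
      endpoints are distinct and increasing.\<close>
    let ?V1 = "V \<inter> {..c}" and ?V2 = "V \<inter> {c..}"
    let ?L = "{e. snd e \<le> c}" and ?R = "{e. c \<le> fst e}"
    let ?P1 = "\<lparr>verts = ?V1, mand = M \<inter> ?L, forb = F \<inter> ?L, anchors = {a, c}\<rparr>"
    let ?P2 = "\<lparr>verts = ?V2, mand = M \<inter> ?R, forb = F \<inter> ?R, anchors = {c, b}\<rparr>"
    have "realizable 2 ?P1"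
    proof (rule less.hyps)
      \<comment> \<open>Each part loses an extreme vertex: the left one \<open>b\<close>, the right
        one \<open>a\<close>. Hence the measure drops even if all edges lie in one part.\<close>
      have "b \<notin> ?V1" using c(3) by (simp add: not_le)
      then have "card ?V1 < card V"
        using prems(1,3) by (intro psubset_card_mono) blast+
      moreover have "card (M \<inter> ?L \<union> F \<inter> ?L) \<le> card (M \<union> F)"
        by (rule card_mono[OF finE]) auto
      ultimately show "card ?V1 + card (M \<inter> ?L \<union> F \<inter> ?L) < card V + card (M \<union> F)" by simp
      show "?V1 \<subseteq> {a..c}" using le(1) by auto
      show "M \<inter> ?L \<union> F \<inter> ?L \<subseteq> {(i, j). i \<in> ?V1 \<and> j \<in> ?V1 \<and> i < j}"
        using in_V by fastforce
      show "\<not> cross e f" if "e \<in> M \<inter> ?L \<union> F \<inter> ?L" "f \<in> M \<inter> ?L \<union> F \<inter> ?L" for e f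
        by (rule prems(7)) (use that in blast)+
    qed (use prems(1,2,6) ac c in auto)
    moreover have "realizable 2 ?P2"
    proof (rule less.hyps)
      have "a \<notin> ?V2" using c(2) by (simp add: not_le)
      then have "card ?V2 < card V"
        using prems(1,2) by (intro psubset_card_mono) blast+
      moreover have "card (M \<inter> ?R \<union> F \<inter> ?R) \<le> card (M \<union> F)"
        by (rule card_mono[OF finE]) auto
      ultimately show "card ?V2 + card (M \<inter> ?R \<union> F \<inter> ?R) < card V + card (M \<union> F)" by simp
      show "?V2 \<subseteq> {c..b}" using le(2) by auto
      show "M \<inter> ?R \<union> F \<inter> ?R \<subseteq> {(i, j). i \<in> ?V2 \<and> j \<in> ?V2 \<and> i < j}"
        using in_V by fastforce
      \<comment> \<open>The left part contains \<open>(a, c)\<close>. The right part contains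
        \<open>(d, b)\<close>: as \<open>b\<close> is beyond \<open>c\<close>, \<open>side\<close>
        leaves only \<open>c \<le> d\<close>.\<close>
      show "M \<inter> ?R \<union> F \<inter> ?R \<noteq> {}" using side[OF split(2)] split(2) c(3) by auto
      show "\<not> cross e f" if "e \<in> M \<inter> ?R \<union> F \<inter> ?R" "f \<in> M \<inter> ?R \<union> F \<inter> ?R" for e f
        by (rule prems(7)) (use that in blast)+
    qed (use prems(1,3,6) c in auto)
    moreover have "is_merge ?P ?P1 ?P2"
    proof -
      have M: "M \<inter> ?L \<union> M \<inter> ?R = M" and F: "F \<inter> ?L \<union> F \<inter> ?R = F"
        using side by fastforce+
      have "(M \<inter> ?L \<union> F \<inter> ?L) \<inter> (M \<inter> ?R \<union> F \<inter> ?R) = {}"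
        using in_V by fastforce
      \<comment> \<open>A vertex only in the left part and one only in the right part have
        \<open>c\<close> strictly between them.\<close>
      moreover have "\<not> (\<exists>u v. consecutive V u v \<and>
          (u \<in> ?V1 - ?V2 \<and> v \<in> ?V2 - ?V1 \<or> u \<in> ?V2 - ?V1 \<and> v \<in> ?V1 - ?V2))"
        using c(1) by (auto simp: consecutive_def not_le)
      ultimately show ?thesis
        unfolding is_merge_def edges_def using M F c by auto
    qed
    ultimately show ?thesis using realizable_merge anch card2 by blast
  qed
qed

theorem theorem6:
  fixes P :: "'a::linorder pattern"
  assumes "is_pattern P"
    and "outerplanar P"
  shows "merge_width P \<le> 2"
proof (cases "edges P = {}")
  case True
  then show ?thesis by (simp add: merge_width_def)
next
  case False
  let ?V = "verts P"
  have fin: "finite ?V" and ne: "?V \<noteq> {}"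
    using assms(1) False by (auto simp: is_pattern_def)
  \<comment> \<open>An edge provides vertices, so the least and the greatest vertex exist. Anchoring
    them at the root is allowed because merge-width leaves the root anchors free.\<close>
  have "realizable 2
      \<lparr>verts = ?V, mand = mand P, forb = forb P, anchors = {Min ?V, Max ?V}\<rparr>"
    by (rule realizable_noncrossing)
      (use fin ne False assms in \<open>auto simp: is_pattern_def outerplanar_def edges_def\<close>)
  then have "merge_width P \<le> enat 2"
    by (rule merge_width_le_if_realizable) (simp add: pattern.truncate_def)
  then show ?thesis by (simp add: numeral_eq_enat)
qed

end
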